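(* Let $\alpha_5,\dots,\alpha_8,\beta_5,\dots,\beta_8$ be real numbers. The double inequalities $$\frac{\alpha_{5}}{H(a,b)}+\frac{1-\alpha_{5}}{A(a,b)}<\frac{1}{N_{AH}(a,b)}<\frac{\beta_{5}}{H(a,b)}+\frac{1-\beta_{5}}{A(a,b)},$$ $$\frac{\alpha_{6}}{H(a,b)}+\frac{1-\alpha_{6}}{A(a,b)}<\frac{1}{N_{HA}(a,b)}<\frac{\beta_{6}}{H(a,b)}+\frac{1-\beta_{6}}{A(a,b)},$$ $$\frac{\alpha_{7}}{A(a,b)}+\frac{1-\alpha_{7}}{C(a,b)}<\frac{1}{N_{CA}(a,b)}<\frac{\beta_{7}}{A(a,b)}+\frac{1-\beta_{7}}{C(a,b)},$$ $$\frac{\alpha_{8}}{A(a,b)}+\frac{1-\alpha_{8}}{C(a,b)}<\frac{1}{N_{AC}(a,b)}<\frac{\beta_{8}}{A(a,b)}+\frac{1-\beta_{8}}{C(a,b)}$$ hold for all $a,b>0$ with $a\neq b$ if and only if $\alpha_{5}\leq 0$, $\beta_{5}\geq 2/3$, $\alpha_{6}\leq 0$, $\beta_{6}\geq 1/3$, $\alpha_{7}\leq [2\sqrt{3}-\log(2+\sqrt{3})]/[2\sqrt{3}+\log(2+\sqrt{3})]=0.4490\ldots$, $\beta_{7}\geq 2/3$, $\alpha_{8}\leq (9\sqrt{3}-4\pi)/(3\sqrt{3}+4\pi)=0.1701\ldots$ and $\beta_{8}\geq 1/3$.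
   Context: For $a,b>0$: $H(a,b)=\frac{2ab}{a+b}$ (harmonic mean), $A(a,b)=\frac{a+b}{2}$ (arithmetic mean), $C(a,b)=\frac{a^2+b^2}{a+b}$ (contraharmonic mean). For $x,y>0$ with $x\neq y$, the Schwab-Borchardt mean is $$SB(x,y)=\begin{cases}\dfrac{\sqrt{y^2-x^2}}{\cos^{-1}(x/y)}, & x<y,\\[2mm] \dfrac{\sqrt{x^2-y^2}}{\cosh^{-1}(x/y)}, & x>y,\end{cases}$$ where $\cos^{-1}$ is the inverse cosine and $\cosh^{-1}(x)=\log(x+\sqrt{x^2-1})$. The Neuman mean is $$N(x,y)=\frac12\left[x+\frac{y^2}{SB(x,y)}\right].$$ For $a\ne b$: $N_{AH}(a,b)=N(A(a,b),H(a,b))$, $N_{HA}(a,b)=N(H(a,b),A(a,b))$, $N_{CA}(a,b)=N(C(a,b),A(a,b))$, $N_{AC}(a,b)=N(A(a,b),C(a,b))$. *)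

theory Defs
  imports Complex_Main
begin

definition harmonic_mean :: "real \<Rightarrow> real \<Rightarrow> real" where
  "harmonic_mean a b = 2 * a * b / (a + b)"

definition arithmetic_mean :: "real \<Rightarrow> real \<Rightarrow> real" where
  "arithmetic_mean a b = (a + b) / 2"

definition contraharmonic_mean :: "real \<Rightarrow> real \<Rightarrow> real" where
  "contraharmonic_mean a b = (a\<^sup>2 + b\<^sup>2) / (a + b)"

(* Meaningful only for x, y > 0 with x \<noteq> y; the diagonal is left unspecified. *)
definition schwab_borchardt :: "real \<Rightarrow> real \<Rightarrow> real" where
  "schwab_borchardt x y =
     (if x < y then sqrt (y\<^sup>2 - x\<^sup>2) / arccos (x / y)
      else if x > y then sqrt (x\<^sup>2 - y\<^sup>2) / arcosh (x / y)
      else undefined)"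

definition neuman_mean :: "real \<Rightarrow> real \<Rightarrow> real" where
  "neuman_mean x y = 1 / 2 * (x + y\<^sup>2 / schwab_borchardt x y)"

definition N_AH :: "real \<Rightarrow> real \<Rightarrow> real" where
  "N_AH a b = neuman_mean (arithmetic_mean a b) (harmonic_mean a b)"

definition N_HA :: "real \<Rightarrow> real \<Rightarrow> real" where
  "N_HA a b = neuman_mean (harmonic_mean a b) (arithmetic_mean a b)"

definition N_CA :: "real \<Rightarrow> real \<Rightarrow> real" where
  "N_CA a b = neuman_mean (contraharmonic_mean a b) (arithmetic_mean a b)"

definition N_AC :: "real \<Rightarrow> real \<Rightarrow> real" where
  "N_AC a b = neuman_mean (arithmetic_mean a b) (contraharmonic_mean a b)"

end

theory Submission
  imports Defs "HOL-Real_Asymp.Real_Asymp" "HOL-Analysis.Harmonic_Numbers"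
begin

text \<open>
  Put \<open>k(c) = 1 / SB(c, 1)\<close>. On both branches \<open>k' = (c k - 1) / (1 - c\<^sup>2)\<close>, and
  \<open>N(x, y) = y (c + k(c)) / 2\<close> with \<open>c = x / y\<close>. Hence \<open>1 / N(x, y) = w(c) / y + (1 - w(c)) / x\<close>
  with \<open>w(c) = (c - k) / ((c - 1) (c + k))\<close>. Since the ratios \<open>A/H\<close>, \<open>H/A\<close>, \<open>C/A\<close>, \<open>A/C\<close>
  range over \<open>(1, \<infinity>)\<close>, \<open>(0, 1)\<close>, \<open>(1, 2)\<close>, \<open>(1/2, 1)\<close>, the optimal constants are the extreme
  values of \<open>w\<close> or \<open>1 - w\<close> there.

  The bounds \<open>3 / (c + 2) < k(c) < (c + 2) / (2 c + 1)\<close> of Cusa--Huygens type give the limits of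
  \<open>w\<close> at \<open>0\<close>, \<open>1\<close> and \<open>\<infinity>\<close>; the upper one also makes \<open>w'\<close> negative, as it turns the
  numerator of \<open>w'\<close> into a negative multiple of \<open>c (1 - c\<^sup>2)\<^sup>2\<close>.
\<close>

section \<open>Cusa-Huygens type inequalities\<close>

text \<open>Each difference of the two sides vanishes at 0. After eliminating the sine, its
  derivative is \<open>(1 - cos x)^2\<close> times a positive factor.\<close>

lemma cusa_huygens_bounds:
  fixes t :: real
  assumes "0 < t" "t \<le> pi / 2"
  shows "3 * sin t / (2 + cos t) < t" "t < sin t * (2 + cos t) / (1 + 2 * cos t)"
proof -
  have cos: "0 < cos x" "cos x < 1" if "0 < x" "x < t" for x
    using that assms cos_gt_zero[of x] cos_monotone_0_pi[of 0 x] by auto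
  \<comment> \<open>The weak inequality includes the endpoints, where continuity needs nonzero
    denominators and the cosine may be 0 or 1.\<close>
  have cos': "0 \<le> cos x" if "0 \<le> x" "x \<le> t" for x
    using that assms by (intro cos_ge_zero) auto
  define f where "f x = x - 3 * sin x / (2 + cos x)" for x :: real
  define g where "g x = sin x * (2 + cos x) / (1 + 2 * cos x) - x" for x :: real
  have sq: "sin x * sin x = 1 - cos x * cos x" for x :: real
    using sin_squared_eq[of x] by (simp add: power2_eq_square)
  have "f 0 < f t"
  proof (rule DERIV_pos_imp_increasing_open[OF assms(1)])
    fix x assume x: "0 < x" "x < t"
    note c = cos[OF x]
    have "(f has_real_derivative
        1 - (3 * cos x * (2 + cos x) + 3 * (sin x * sin x)) / (2 + cos x)\<^sup>2) (at x)"
      unfolding f_def using c by (auto intro!: derivative_eq_intros simp: power2_eq_square)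
    also have "1 - (3 * cos x * (2 + cos x) + 3 * (sin x * sin x)) / (2 + cos x)\<^sup>2
        = ((1 - cos x) / (2 + cos x))\<^sup>2"
      unfolding sq using c by (simp add: divide_simps) (simp add: power2_eq_square algebra_simps)
    finally have "(f has_real_derivative ((1 - cos x) / (2 + cos x))\<^sup>2) (at x)" .
    moreover have "0 < ((1 - cos x) / (2 + cos x))\<^sup>2" using c by simp
    ultimately show "\<exists>y. (f has_real_derivative y) (at x) \<and> 0 < y" by blast
  next
    show "continuous_on {0..t} f"
      unfolding f_def by (intro continuous_intros) (use cos' in fastforce)
  qed
  thus "3 * sin t / (2 + cos t) < t" by (simp add: f_def)
  have "g 0 < g t"
  proof (rule DERIV_pos_imp_increasing_open[OF assms(1)])
    fix x assume x: "0 < x" "x < t"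
    note c = cos[OF x]
    have "(g has_real_derivative ((cos x * (2 + cos x) - sin x * sin x) * (1 + 2 * cos x)
        + 2 * (sin x * sin x) * (2 + cos x)) / (1 + 2 * cos x)\<^sup>2 - 1) (at x)"
      unfolding g_def using c
      by (auto intro!: derivative_eq_intros simp: power2_eq_square algebra_simps)
    also have "((cos x * (2 + cos x) - sin x * sin x) * (1 + 2 * cos x)
        + 2 * (sin x * sin x) * (2 + cos x)) / (1 + 2 * cos x)\<^sup>2 - 1
        = 2 * (1 - cos x)\<^sup>2 * (1 + cos x) / (1 + 2 * cos x)\<^sup>2"
      unfolding sq using c by (simp add: divide_simps) (simp add: power2_eq_square algebra_simps)
    finally have "(g has_real_derivative
        2 * (1 - cos x)\<^sup>2 * (1 + cos x) / (1 + 2 * cos x)\<^sup>2) (at x)" .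
    moreover have "0 < 2 * (1 - cos x)\<^sup>2 * (1 + cos x) / (1 + 2 * cos x)\<^sup>2" using c by simp
    ultimately show "\<exists>y. (g has_real_derivative y) (at x) \<and> 0 < y" by blast
  next
    show "continuous_on {0..t} g"
      unfolding g_def by (intro continuous_intros) (use cos' in fastforce)
  qed
  thus "t < sin t * (2 + cos t) / (1 + 2 * cos t)" by (simp add: g_def)
qed

text \<open>The sign changes in the derivative of \<open>cosh\<close> and in
  \<open>sinh x * sinh x = cosh x * cosh x - 1\<close> cancel, so the derivatives have the
  trigonometric form with \<open>cosh\<close> for \<open>cos\<close>.\<close>

lemma cusa_huygens_bounds_hyperbolic:
  fixes t :: real
  assumes "0 < t"
  shows "3 * sinh t / (2 + cosh t) < t" "t < sinh t * (2 + cosh t) / (1 + 2 * cosh t)"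
proof -
  have cosh: "1 < cosh x" if "0 < x" for x :: real
    using that cosh_real_strict_mono[of 0 x] by simp
  have cosh': "0 < cosh x" for x :: real by simp
  define f where "f x = x - 3 * sinh x / (2 + cosh x)" for x :: real
  define g where "g x = sinh x * (2 + cosh x) / (1 + 2 * cosh x) - x" for x :: real
  have sq: "sinh x * sinh x = cosh x * cosh x - 1" for x :: real
    using sinh_square_eq[of x] by (simp add: power2_eq_square)
  have "f 0 < f t"
  proof (rule DERIV_pos_imp_increasing_open[OF assms(1)])
    fix x assume x: "0 < x" "x < t"
    note c = cosh[OF x(1)]
    have "(f has_real_derivative
        1 - (3 * cosh x * (2 + cosh x) - 3 * (sinh x * sinh x)) / (2 + cosh x)\<^sup>2) (at x)"
      unfolding f_def using c by (auto intro!: derivative_eq_intros simp: power2_eq_square)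
    also have "1 - (3 * cosh x * (2 + cosh x) - 3 * (sinh x * sinh x)) / (2 + cosh x)\<^sup>2
        = ((1 - cosh x) / (2 + cosh x))\<^sup>2"
      unfolding sq using c by (simp add: divide_simps) (simp add: power2_eq_square algebra_simps)
    finally have "(f has_real_derivative ((1 - cosh x) / (2 + cosh x))\<^sup>2) (at x)" .
    moreover have "0 < ((1 - cosh x) / (2 + cosh x))\<^sup>2" using c x by simp
    ultimately show "\<exists>y. (f has_real_derivative y) (at x) \<and> 0 < y" by blast
  next
    show "continuous_on {0..t} f"
      unfolding f_def by (intro continuous_intros)
        (use cosh' in \<open>simp add: add_pos_pos less_imp_neq[symmetric]\<close>)
  qed
  thus "3 * sinh t / (2 + cosh t) < t" by (simp add: f_def)
  have "g 0 < g t"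
  proof (rule DERIV_pos_imp_increasing_open[OF assms(1)])
    fix x assume x: "0 < x" "x < t"
    note c = cosh[OF x(1)]
    have "(g has_real_derivative ((cosh x * (2 + cosh x) + sinh x * sinh x) * (1 + 2 * cosh x)
        - 2 * (sinh x * sinh x) * (2 + cosh x)) / (1 + 2 * cosh x)\<^sup>2 - 1) (at x)"
      unfolding g_def using c
      by (auto intro!: derivative_eq_intros simp: power2_eq_square algebra_simps)
    also have "((cosh x * (2 + cosh x) + sinh x * sinh x) * (1 + 2 * cosh x)
        - 2 * (sinh x * sinh x) * (2 + cosh x)) / (1 + 2 * cosh x)\<^sup>2 - 1
        = 2 * (1 - cosh x)\<^sup>2 * (1 + cosh x) / (1 + 2 * cosh x)\<^sup>2"
      unfolding sq using c by (simp add: divide_simps) (simp add: power2_eq_square algebra_simps)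
    finally have "(g has_real_derivative
        2 * (1 - cosh x)\<^sup>2 * (1 + cosh x) / (1 + 2 * cosh x)\<^sup>2) (at x)" .
    moreover have "0 < 2 * (1 - cosh x)\<^sup>2 * (1 + cosh x) / (1 + 2 * cosh x)\<^sup>2" using c x by simp
    ultimately show "\<exists>y. (g has_real_derivative y) (at x) \<and> 0 < y" by blast
  next
    show "continuous_on {0..t} g"
      unfolding g_def by (intro continuous_intros)
        (use cosh' in \<open>simp add: add_pos_pos less_imp_neq[symmetric]\<close>)
  qed
  thus "t < sinh t * (2 + cosh t) / (1 + 2 * cosh t)" by (simp add: g_def)
qed

section \<open>The normalized reciprocal Schwab-Borchardt mean\<close>

text \<open>This is \<open>t / sin t\<close> for \<open>c = cos t\<close> and
  \<open>t / sinh t\<close> for \<open>c = cosh t\<close>. The value at \<open>c = 1\<close> is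
  unspecified, hence the hypothesis \<open>c \<noteq> 1\<close> below.\<close>

definition inverse_SB :: "real \<Rightarrow> real" where
  "inverse_SB c = 1 / schwab_borchardt c 1"

lemma inverse_SB_less_1: "c < 1 \<Longrightarrow> inverse_SB c = arccos c / sqrt (1 - c\<^sup>2)"
  by (simp add: inverse_SB_def schwab_borchardt_def)

lemma inverse_SB_greater_1: "c > 1 \<Longrightarrow> inverse_SB c = arcosh c / sqrt (c\<^sup>2 - 1)"
  by (simp add: inverse_SB_def schwab_borchardt_def)

text \<open>Put \<open>t = arccos c\<close> or \<open>t = arcosh c\<close> and divide the
  Cusa-Huygens bounds by \<open>sin t\<close> or \<open>sinh t\<close>; both branches give the same
  rational functions of \<open>c\<close>.\<close>

lemma inverse_SB_bounds:
  assumes "0 < c" "c \<noteq> 1"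
  shows "3 / (c + 2) < inverse_SB c" "inverse_SB c < (c + 2) / (2 * c + 1)"
proof -
  consider "c < 1" | "c > 1" using assms by linarith
  hence "3 / (c + 2) < inverse_SB c \<and> inverse_SB c < (c + 2) / (2 * c + 1)"
  proof cases
    case 1
    have t: "0 < arccos c" "arccos c \<le> pi / 2"
      using arccos_less_arccos[of c 1] arccos_le_arccos[of 0 c] assms 1 by auto
    have "c\<^sup>2 < 1" using assms 1 by (simp add: power_less_one_iff)
    thus ?thesis
      using cusa_huygens_bounds[OF t] assms 1
      by (simp add: inverse_SB_less_1 sin_arccos field_simps)
  next
    case 2
    have t: "0 < arcosh c" using 2 by simp
    have "c\<^sup>2 > 1" using 2 by (simp add: one_less_power)
    thus ?thesis
      using cusa_huygens_bounds_hyperbolic[OF t] assms 2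
      by (simp add: inverse_SB_greater_1 sinh_arcosh_real field_simps)
  qed
  thus "3 / (c + 2) < inverse_SB c" "inverse_SB c < (c + 2) / (2 * c + 1)" by auto
qed

lemma inverse_SB_pos: "0 < c \<Longrightarrow> c \<noteq> 1 \<Longrightarrow> 0 < inverse_SB c"
  using inverse_SB_bounds(1)[of c] by (smt (verit) divide_pos_pos)

lemma DERIV_inverse_SB:
  assumes "0 < c" "c \<noteq> 1"
  shows "(inverse_SB has_real_derivative (c * inverse_SB c - 1) / (1 - c\<^sup>2)) (at c)"
proof -
  consider "c < 1" | "c > 1" using assms by linarith
  thus ?thesis
  proof cases
    case 1
    have c2: "0 < 1 - c\<^sup>2" using assms 1 by (simp add: power_less_one_iff)
    have "((\<lambda>c. arccos c / sqrt (1 - c\<^sup>2)) has_real_derivative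
        (- 1 + c * (arccos c / sqrt (1 - c\<^sup>2))) / (1 - c\<^sup>2)) (at c)"
      using c2 assms 1
      by (auto intro!: derivative_eq_intros simp: divide_simps)
    hence "((\<lambda>c. arccos c / sqrt (1 - c\<^sup>2)) has_real_derivative
        (c * inverse_SB c - 1) / (1 - c\<^sup>2)) (at c)"
      using 1 by (simp add: inverse_SB_less_1)
    thus ?thesis
      \<comment> \<open>The branch formula agrees with \<open>inverse_SB\<close> on an open
        half-line around \<open>c\<close>, which suffices for the derivative.\<close>
      by (rule has_field_derivative_transform_within_open[where S = "{..<1}"])
         (use 1 in \<open>auto simp: inverse_SB_less_1\<close>)
  next
    case 2
    have c2: "0 < c\<^sup>2 - 1" using 2 by (simp add: one_less_power)
    hence c2': "c\<^sup>2 \<noteq> 1" "\<not> c\<^sup>2 < 1" by auto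
    have "((\<lambda>c. arcosh c / sqrt (c\<^sup>2 - 1)) has_real_derivative
        (1 - c * (arcosh c / sqrt (c\<^sup>2 - 1))) / (c\<^sup>2 - 1)) (at c)"
      using c2 c2' assms 2
      by (auto intro!: derivative_eq_intros simp: divide_simps)
    also have "(1 - c * (arcosh c / sqrt (c\<^sup>2 - 1))) / (c\<^sup>2 - 1) = (c * inverse_SB c - 1) / (1 - c\<^sup>2)"
      using 2 minus_divide_divide[of "c * inverse_SB c - 1" "1 - c\<^sup>2"] by (simp add: inverse_SB_greater_1)
    finally show ?thesis
      by (rule has_field_derivative_transform_within_open[where S = "{1<..}"])
         (use 2 in \<open>auto simp: inverse_SB_greater_1\<close>)
  qed
qed

section \<open>The Neuman mean and its weight\<close>

text \<open>The Schwab-Borchardt mean is homogeneous of degree one, so \<open>y\<close> factors out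
  and only the ratio \<open>x / y\<close> remains.\<close>

lemma neuman_mean_eq:
  assumes "0 < x" "0 < y" "x \<noteq> y"
  shows "neuman_mean x y = y / 2 * (x / y + inverse_SB (x / y))"
proof -
  have "sqrt (y\<^sup>2 - x\<^sup>2) = y * sqrt (1 - (x / y)\<^sup>2)"
    "sqrt (x\<^sup>2 - y\<^sup>2) = y * sqrt ((x / y)\<^sup>2 - 1)"
  proof -
    have "y\<^sup>2 - x\<^sup>2 = y\<^sup>2 * (1 - (x / y)\<^sup>2)" "x\<^sup>2 - y\<^sup>2 = y\<^sup>2 * ((x / y)\<^sup>2 - 1)"
      using assms by (simp_all add: field_simps)
    thus "sqrt (y\<^sup>2 - x\<^sup>2) = y * sqrt (1 - (x / y)\<^sup>2)"
      "sqrt (x\<^sup>2 - y\<^sup>2) = y * sqrt ((x / y)\<^sup>2 - 1)"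
      using assms by (simp_all add: real_sqrt_mult)
  qed
  hence "schwab_borchardt x y = y * schwab_borchardt (x / y) 1"
    using assms by (simp add: schwab_borchardt_def)
  thus ?thesis
    using assms by (simp add: neuman_mean_def inverse_SB_def algebra_simps power2_eq_square)
qed

text \<open>At \<open>c = 1\<close> division by zero yields 0 and not the limit 2/3, so the two
  sides of 1 are treated separately.\<close>

definition neuman_weight :: "real \<Rightarrow> real" where
  "neuman_weight c = (c - inverse_SB c) / ((c - 1) * (c + inverse_SB c))"

text \<open>The weight is the solution \<open>w\<close> of
  \<open>1 + (c - 1) * w = 2 * c / (c + k)\<close>, where \<open>c = x / y\<close> and
  \<open>k = inverse_SB c\<close>.\<close>

lemma inverse_neuman_mean:
  assumes "0 < x" "0 < y" "x \<noteq> y"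
  shows "1 / neuman_mean x y = neuman_weight (x / y) / y + (1 - neuman_weight (x / y)) / x"
proof -
  define c where "c = x / y"
  define k where "k = inverse_SB c"
  have c: "0 < c" "c \<noteq> 1" "x = c * y" using assms by (auto simp: c_def)
  have k: "0 < c + k" using inverse_SB_pos c by (simp add: k_def add_pos_pos)
  have "neuman_weight c / y + (1 - neuman_weight c) / x = (1 + (c - 1) * neuman_weight c) / (c * y)"
    using c assms by (simp add: field_simps)
  also have "1 + (c - 1) * neuman_weight c = 2 * c / (c + k)"
    using c k by (simp add: neuman_weight_def flip: k_def) (simp add: field_simps)
  also have "2 * c / (c + k) / (c * y) = 1 / neuman_mean x y"
    using c k assms by (simp add: neuman_mean_eq flip: c_def k_def)
  finally show ?thesis by (simp add: c_def)
qed

section \<open>Rational bounds and limits of the weight\<close>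

lemma divide_less_divide_cross:
  fixes x y z w :: "'a :: linordered_field"
  shows "0 < y \<Longrightarrow> 0 < z \<Longrightarrow> x * z < w * y \<Longrightarrow> x / y < w / z"
  by (simp add: field_simps)

text \<open>For fixed \<open>c > 1\<close> the weight decreases in \<open>k\<close>. Inserting the
  upper and lower bounds of \<open>k\<close> gives these fractions, in which the factor
  \<open>c - 1\<close> has cancelled.\<close>

lemma neuman_weight_bounds_greater_1:
  assumes "1 < c"
  shows "(c + 1) / (c\<^sup>2 + c + 1) < neuman_weight c"
    "neuman_weight c < (c + 3) / (c\<^sup>2 + 2 * c + 3)"
proof -
  define k where "k = inverse_SB c"
  have k: "0 < k" "3 < (c + 2) * k" "(2 * c + 1) * k < c + 2"
    using inverse_SB_bounds[of c] inverse_SB_pos[of c] assms by (auto simp: k_def field_simps)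
  have d: "0 < (c - 1) * (c + k)" using assms k by simp
  have e: "0 < c\<^sup>2 + c + 1" "0 < c\<^sup>2 + 2 * c + 3" using assms by (simp_all add: add_pos_pos)
  have "(c + 1) * ((c - 1) * (c + k)) < (c - k) * (c\<^sup>2 + c + 1)"
  proof -
    \<comment> \<open>The cross-multiplied difference is a positive multiple of the slack in the
      upper bound for \<open>k\<close>; the other inequality uses the lower bound in the same
      way.\<close>
    have "(c - k) * (c\<^sup>2 + c + 1) - (c + 1) * ((c - 1) * (c + k)) = c * (c + 2 - (2 * c + 1) * k)"
      by (simp add: power2_eq_square algebra_simps)
    thus ?thesis using k assms by (smt (verit) mult_pos_pos)
  qed
  thus "(c + 1) / (c\<^sup>2 + c + 1) < neuman_weight c"
    using d e unfolding neuman_weight_def k_def[symmetric] by (intro divide_less_divide_cross)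
  have "(c - k) * (c\<^sup>2 + 2 * c + 3) < (c + 3) * ((c - 1) * (c + k))"
  proof -
    have "(c + 3) * ((c - 1) * (c + k)) - (c - k) * (c\<^sup>2 + 2 * c + 3) = 2 * c * ((c + 2) * k - 3)"
      by (simp add: power2_eq_square algebra_simps)
    thus ?thesis using k assms by (smt (verit) mult_pos_pos)
  qed
  thus "neuman_weight c < (c + 3) / (c\<^sup>2 + 2 * c + 3)"
    using d e unfolding neuman_weight_def k_def[symmetric] by (intro divide_less_divide_cross)
qed

text \<open>For \<open>c < 1\<close> the factor \<open>c - 1\<close> is negative and the weight
  increases in \<open>k\<close>, so the same two fractions change roles.\<close>

lemma neuman_weight_bounds_less_1:
  assumes "0 < c" "c < 1"
  shows "(c + 3) / (c\<^sup>2 + 2 * c + 3) < neuman_weight c"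
    "neuman_weight c < (c + 1) / (c\<^sup>2 + c + 1)"
proof -
  define k where "k = inverse_SB c"
  have k: "0 < k" "3 < (c + 2) * k" "(2 * c + 1) * k < c + 2"
    using inverse_SB_bounds[of c] inverse_SB_pos[of c] assms by (auto simp: k_def field_simps)
  have d: "0 < (1 - c) * (c + k)" using assms k by simp
  have e: "0 < c\<^sup>2 + c + 1" "0 < c\<^sup>2 + 2 * c + 3" using assms by (simp_all add: add_pos_pos)
  have w: "neuman_weight c = (k - c) / ((1 - c) * (c + k))"
    using minus_divide_divide[of "k - c" "(1 - c) * (c + k)"]
    by (simp add: neuman_weight_def minus_mult_left flip: k_def)
  have "(k - c) * (c\<^sup>2 + c + 1) < (c + 1) * ((1 - c) * (c + k))"
  proof -
    have "(c + 1) * ((1 - c) * (c + k)) - (k - c) * (c\<^sup>2 + c + 1) = c * (c + 2 - (2 * c + 1) * k)"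
      by (simp add: power2_eq_square algebra_simps)
    thus ?thesis using k assms by (smt (verit) mult_pos_pos)
  qed
  thus "neuman_weight c < (c + 1) / (c\<^sup>2 + c + 1)"
    using d e unfolding w by (intro divide_less_divide_cross)
  have "(c + 3) * ((1 - c) * (c + k)) < (k - c) * (c\<^sup>2 + 2 * c + 3)"
  proof -
    have "(k - c) * (c\<^sup>2 + 2 * c + 3) - (c + 3) * ((1 - c) * (c + k)) = 2 * c * ((c + 2) * k - 3)"
      by (simp add: power2_eq_square algebra_simps)
    thus ?thesis using k assms by (smt (verit) mult_pos_pos)
  qed
  thus "(c + 3) / (c\<^sup>2 + 2 * c + 3) < neuman_weight c"
    using d e unfolding w by (intro divide_less_divide_cross)
qed

text \<open>The two rational bounds have equal limits at each of these points, so the weight is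
  squeezed.\<close>

lemma tendsto_neuman_weight:
  "(neuman_weight \<longlongrightarrow> 2 / 3) (at_right 1)" "(neuman_weight \<longlongrightarrow> 2 / 3) (at_left 1)"
  "(neuman_weight \<longlongrightarrow> 0) at_top" "(neuman_weight \<longlongrightarrow> 1) (at_right 0)"
proof -
  have gt: "eventually (\<lambda>c. 1 < c) (at_right (1::real))" "eventually (\<lambda>c. 1 < c) (at_top :: real filter)"
    and lt: "eventually (\<lambda>c. 0 < c \<and> c < 1) (at_left (1::real))"
      "eventually (\<lambda>c. 0 < c \<and> c < 1) (at_right (0::real))"
    by (real_asymp | auto simp: eventually_at_left[of 0] eventually_at_right[of _ 1] intro: exI[of _ 0] exI[of _ 1])+
  show "(neuman_weight \<longlongrightarrow> 2 / 3) (at_right 1)"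
  proof (rule tendsto_sandwich)
    show "((\<lambda>c::real. (c + 1) / (c\<^sup>2 + c + 1)) \<longlongrightarrow> 2 / 3) (at_right 1)"
      "((\<lambda>c::real. (c + 3) / (c\<^sup>2 + 2 * c + 3)) \<longlongrightarrow> 2 / 3) (at_right 1)" by real_asymp+
  qed (rule eventually_mono[OF gt(1)], use neuman_weight_bounds_greater_1 in \<open>simp add: less_imp_le\<close>)+
  show "(neuman_weight \<longlongrightarrow> 0) at_top"
  proof (rule tendsto_sandwich)
    show "((\<lambda>c::real. (c + 1) / (c\<^sup>2 + c + 1)) \<longlongrightarrow> 0) at_top"
      "((\<lambda>c::real. (c + 3) / (c\<^sup>2 + 2 * c + 3)) \<longlongrightarrow> 0) at_top" by real_asymp+
  qed (rule eventually_mono[OF gt(2)], use neuman_weight_bounds_greater_1 in \<open>simp add: less_imp_le\<close>)+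
  show "(neuman_weight \<longlongrightarrow> 2 / 3) (at_left 1)"
  proof (rule tendsto_sandwich)
    show "((\<lambda>c::real. (c + 3) / (c\<^sup>2 + 2 * c + 3)) \<longlongrightarrow> 2 / 3) (at_left 1)"
      "((\<lambda>c::real. (c + 1) / (c\<^sup>2 + c + 1)) \<longlongrightarrow> 2 / 3) (at_left 1)" by real_asymp+
  qed (rule eventually_mono[OF lt(1)], use neuman_weight_bounds_less_1 in \<open>simp add: less_imp_le\<close>)+
  show "(neuman_weight \<longlongrightarrow> 1) (at_right 0)"
  proof (rule tendsto_sandwich)
    show "((\<lambda>c::real. (c + 3) / (c\<^sup>2 + 2 * c + 3)) \<longlongrightarrow> 1) (at_right 0)"
      "((\<lambda>c::real. (c + 1) / (c\<^sup>2 + c + 1)) \<longlongrightarrow> 1) (at_right 0)" by real_asymp+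
  qed (rule eventually_mono[OF lt(2)], use neuman_weight_bounds_less_1 in \<open>simp add: less_imp_le\<close>)+
qed

section \<open>Monotonicity of the weight\<close>

lemma DERIV_neuman_weight:
  assumes "0 < c" "c \<noteq> 1"
  shows "\<exists>y. (neuman_weight has_real_derivative y) (at c) \<and> y < 0"
proof -
  define k where "k = inverse_SB c"
  define D where "D = (c * k - 1) / (1 - c\<^sup>2)"
  have k: "0 < k" "3 < (c + 2) * k" "(2 * c + 1) * k < c + 2"
    using inverse_SB_bounds[of c] inverse_SB_pos[of c] assms by (auto simp: k_def field_simps)
  have c2: "1 - c\<^sup>2 \<noteq> 0" using assms by (auto simp: power2_eq_1_iff)
  \<comment> \<open>In this form the differential equation eliminates \<open>D\<close> from
    \<open>(c + 1) * num\<close>, leaving the polynomial \<open>Q\<close>, quadratic in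
    \<open>k\<close>, with the same sign as \<open>num\<close>.\<close>
  have D: "D * (c - 1) * (1 + c) = 1 - c * k"
    using c2 by (simp add: D_def field_simps power2_eq_square)
  define Q where "Q = (c + 1) * k\<^sup>2 + 2 * (2 * c\<^sup>2 - 1) * k - 2 * c - c\<^sup>2 * (c + 1)"
  define den where "den = (c - 1) * (c + k)"
  have den: "den \<noteq> 0" using assms k by (auto simp: den_def)
  define num where "num = (1 - D) * den - (c - k) * ((c + k) + (c - 1) * (1 + D))"
  have k': "(inverse_SB has_real_derivative D) (at c)"
    using DERIV_inverse_SB[OF assms] by (simp add: D_def k_def)
  have "((\<lambda>c. (c - inverse_SB c) / ((c - 1) * (c + inverse_SB c))) has_real_derivative num / den\<^sup>2) (at c)"
    by (rule DERIV_cong[OF DERIV_divide[OF DERIV_diff[OF DERIV_ident k'] DERIV_mult[OF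
          DERIV_diff[OF DERIV_ident DERIV_const] DERIV_add[OF DERIV_ident k']]]])
      (use den in \<open>simp_all add: num_def power2_eq_square mult.commute add.commute flip: k_def den_def\<close>)
  hence "(neuman_weight has_real_derivative num / den\<^sup>2) (at c)"
    by (simp add: neuman_weight_def[abs_def])
  moreover have "(c + 1) * num = Q"
  proof -
    have "(c + 1) * num = 2 * k * (c\<^sup>2 - 1) - 2 * c * (D * (c - 1) * (1 + c)) - (c\<^sup>2 - k\<^sup>2) * (c + 1)"
      by (simp add: num_def den_def power2_eq_square algebra_simps)
    thus ?thesis unfolding D Q_def by (simp add: power2_eq_square algebra_simps)
  qed
  \<comment> \<open>\<open>Q\<close> increases in \<open>k\<close>, so \<open>k\<close> may be replaced by its upper bound \<open>(c + 2) / (2 c + 1)\<close>.\<close>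
  moreover have "Q < 0"
  proof -
    define m where "m = (c + 2) / (2 * c + 1)"
    have m: "(2 * c + 1) * m = c + 2" and km: "k < m" using assms k by (auto simp: m_def field_simps)
    \<comment> \<open>From the lower bound for \<open>k\<close>: \<open>2 * (c + 1) * k\<close>
      exceeds \<open>(c + 2) * k\<close>, which exceeds 3.\<close>
    have "1 < (c + 1) * k"
      using k mult_pos_pos[OF assms(1) k(1)] by (simp add: algebra_simps)
    hence "2 < (c + 1) * (m + k)" using km assms by (smt (verit) mult_less_cancel_left_pos distrib_left)
    moreover have "- 2 \<le> 2 * (2 * c\<^sup>2 - 1)" by simp
    ultimately have "2 + - 2 < (c + 1) * (m + k) + 2 * (2 * c\<^sup>2 - 1)"
      by (rule add_less_le_mono)
    \<comment> \<open>This product is the quadratic evaluated at \<open>m\<close> minus its value at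
      \<open>k\<close>.\<close>
    hence "0 < (m - k) * ((c + 1) * (m + k) + 2 * (2 * c\<^sup>2 - 1))"
      using km by simp
    hence "Q < (c + 1) * m\<^sup>2 + 2 * (2 * c\<^sup>2 - 1) * m - 2 * c - c\<^sup>2 * (c + 1)"
      by (simp add: Q_def power2_eq_square algebra_simps)
    also have "\<dots> = - 4 * c * (1 - c\<^sup>2)\<^sup>2 / (2 * c + 1)\<^sup>2"
      using assms by (simp add: m_def divide_simps) (simp add: power2_eq_square algebra_simps)
    also have "\<dots> < 0" using assms c2 by (simp add: divide_neg_pos)
    finally show ?thesis .
  qed
  ultimately have "num < 0" using assms by (smt (verit) mult_nonneg_nonneg)
  thus ?thesis using den \<open>(neuman_weight has_real_derivative _) _\<close>
    by (intro exI[of _ "num / den\<^sup>2"]) (simp add: divide_neg_pos)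
qed

text \<open>The last assumption keeps 1, where the weight is discontinuous, outside the interval
  from \<open>x\<close> to \<open>y\<close>.\<close>

lemma neuman_weight_strict_antimono:
  assumes "0 < x" "x < y" "y < 1 \<or> 1 < x"
  shows "neuman_weight y < neuman_weight x"
  using assms(2)
  by (rule DERIV_neg_imp_decreasing) (use assms in \<open>auto intro!: DERIV_neuman_weight\<close>)

lemma isCont_neuman_weight: "0 < c \<Longrightarrow> c \<noteq> 1 \<Longrightarrow> isCont neuman_weight c"
  using DERIV_neuman_weight DERIV_isCont by blast

section \<open>Best constants for the weight on each interval\<close>

text \<open>A lower bound that is approached but not attained is the best constant and is itself
  admissible: a strict inequality becomes weak in the limit, and \<open>p = L\<close> still gives a
  strict one.\<close>

lemma all_less_iff_le_limit:
  fixes f :: "'a \<Rightarrow> 'b :: linorder_topology"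
  assumes "(f \<longlongrightarrow> L) F" "F \<noteq> bot" "eventually P F" "\<And>c. P c \<Longrightarrow> L < f c"
  shows "(\<forall>c. P c \<longrightarrow> p < f c) \<longleftrightarrow> p \<le> L"
proof
  assume "\<forall>c. P c \<longrightarrow> p < f c"
  hence "eventually (\<lambda>c. p \<le> f c) F"
    using assms(3) by (auto elim!: eventually_mono intro: less_imp_le)
  thus "p \<le> L" using assms by (intro tendsto_lowerbound[of f L F])
qed (use assms(4) in \<open>auto intro: le_less_trans\<close>)

lemma all_greater_iff_ge_limit:
  fixes f :: "'a \<Rightarrow> 'b :: linorder_topology"
  assumes "(f \<longlongrightarrow> L) F" "F \<noteq> bot" "eventually P F" "\<And>c. P c \<Longrightarrow> f c < L"
  shows "(\<forall>c. P c \<longrightarrow> f c < p) \<longleftrightarrow> L \<le> p"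
proof
  assume "\<forall>c. P c \<longrightarrow> f c < p"
  hence "eventually (\<lambda>c. f c \<le> p) F"
    using assms(3) by (auto elim!: eventually_mono intro: less_imp_le)
  thus "L \<le> p" using assms by (intro tendsto_upperbound[of f L F])
qed (use assms(4) in \<open>auto intro: less_le_trans\<close>)

lemma neuman_weight_greater_1:
  assumes "1 < c"
  shows "0 < neuman_weight c" "neuman_weight c < 2 / 3"
proof -
  have "0 < (c + 1) / (c\<^sup>2 + c + 1)" using assms by (simp add: add_pos_pos)
  thus "0 < neuman_weight c" using neuman_weight_bounds_greater_1(1)[OF assms] by linarith
  have "c < c\<^sup>2" using assms by (simp add: power2_eq_square)
  hence "(c + 3) / (c\<^sup>2 + 2 * c + 3) < 2 / 3"
    using assms by (intro divide_less_divide_cross) auto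
  thus "neuman_weight c < 2 / 3" using neuman_weight_bounds_greater_1(2)[OF assms] by linarith
qed

lemma neuman_weight_less_1:
  assumes "0 < c" "c < 1"
  shows "2 / 3 < neuman_weight c" "neuman_weight c < 1"
proof -
  have "(c + 1) / (c\<^sup>2 + c + 1) < 1" using assms by (simp add: add_pos_pos)
  thus "neuman_weight c < 1" using neuman_weight_bounds_less_1(2)[OF assms] by linarith
  have "c\<^sup>2 < c" using assms by (simp add: power2_eq_square)
  hence "2 / 3 < (c + 3) / (c\<^sup>2 + 2 * c + 3)"
    using assms by (intro divide_less_divide_cross) (auto simp: add_pos_pos)
  thus "2 / 3 < neuman_weight c" using neuman_weight_bounds_less_1(1)[OF assms] by linarith
qed


text \<open>For the ratio A/H: the infimum is approached at infinity, the supremum at 1.\<close>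

lemma neuman_weight_sharp_greater_1:
  "(\<forall>c. 1 < c \<longrightarrow> p < neuman_weight c) \<longleftrightarrow> p \<le> 0"
  "(\<forall>c. 1 < c \<longrightarrow> neuman_weight c < p) \<longleftrightarrow> 2 / 3 \<le> p"
proof -
  show "(\<forall>c. 1 < c \<longrightarrow> p < neuman_weight c) \<longleftrightarrow> p \<le> 0"
    by (rule all_less_iff_le_limit[OF tendsto_neuman_weight(3)])
      (auto simp: neuman_weight_greater_1 eventually_gt_at_top)
  show "(\<forall>c. 1 < c \<longrightarrow> neuman_weight c < p) \<longleftrightarrow> 2 / 3 \<le> p"
    by (rule all_greater_iff_ge_limit[OF tendsto_neuman_weight(1) _ _ neuman_weight_greater_1(2)])
      (simp_all add: eventually_at_right_less)
qed

text \<open>For the ratio C/A, with \<open>b = 2\<close>: by strict decrease and continuity the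
  infimum is the value at the excluded endpoint \<open>b\<close>.\<close>

lemma neuman_weight_sharp_between_1_and:
  assumes "1 < b"
  shows "(\<forall>c. 1 < c \<and> c < b \<longrightarrow> p < neuman_weight c) \<longleftrightarrow> p \<le> neuman_weight b"
    "(\<forall>c. 1 < c \<and> c < b \<longrightarrow> neuman_weight c < p) \<longleftrightarrow> 2 / 3 \<le> p"
proof -
  have "(neuman_weight \<longlongrightarrow> neuman_weight b) (at_left b)"
    using isCont_neuman_weight[of b] assms by (simp add: isCont_def filterlim_at_split)
  thus "(\<forall>c. 1 < c \<and> c < b \<longrightarrow> p < neuman_weight c) \<longleftrightarrow> p \<le> neuman_weight b"
    using eventually_at_left_real[OF assms] assms
    by (intro all_less_iff_le_limit) (auto intro: neuman_weight_strict_antimono)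
  show "(\<forall>c. 1 < c \<and> c < b \<longrightarrow> neuman_weight c < p) \<longleftrightarrow> 2 / 3 \<le> p"
    using eventually_at_right_real[OF assms]
    by (intro all_greater_iff_ge_limit[OF tendsto_neuman_weight(1) _ _ neuman_weight_greater_1(2)]) auto
qed

text \<open>For the ratio H/A. The complement \<open>1 - neuman_weight c\<close> appears because the
  smaller mean is now the first argument of the Neuman mean.\<close>

lemma neuman_weight_sharp_less_1:
  "(\<forall>c. 0 < c \<and> c < 1 \<longrightarrow> p < 1 - neuman_weight c) \<longleftrightarrow> p \<le> 0"
  "(\<forall>c. 0 < c \<and> c < 1 \<longrightarrow> 1 - neuman_weight c < p) \<longleftrightarrow> 1 / 3 \<le> p"
proof -
  have "((\<lambda>c. 1 - neuman_weight c) \<longlongrightarrow> 0) (at_right 0)"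
    using tendsto_diff[OF tendsto_const tendsto_neuman_weight(4), of 1] by simp
  thus "(\<forall>c. 0 < c \<and> c < 1 \<longrightarrow> p < 1 - neuman_weight c) \<longleftrightarrow> p \<le> 0"
    using eventually_at_right_real[of 0 1]
    by (intro all_less_iff_le_limit) (auto simp: neuman_weight_less_1)
  have "((\<lambda>c. 1 - neuman_weight c) \<longlongrightarrow> 1 / 3) (at_left 1)"
    using tendsto_diff[OF tendsto_const tendsto_neuman_weight(2), of 1] by simp
  thus "(\<forall>c. 0 < c \<and> c < 1 \<longrightarrow> 1 - neuman_weight c < p) \<longleftrightarrow> 1 / 3 \<le> p"
    using eventually_at_left_real[of 0 1] neuman_weight_less_1(1)
    by (intro all_greater_iff_ge_limit) force+
qed

text \<open>For the ratio A/C, with \<open>b = 1 / 2\<close>; the complement of the weight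
  increases, so its infimum is approached at \<open>b\<close>.\<close>

lemma neuman_weight_sharp_between_and_1:
  assumes "0 < b" "b < 1"
  shows "(\<forall>c. b < c \<and> c < 1 \<longrightarrow> p < 1 - neuman_weight c) \<longleftrightarrow> p \<le> 1 - neuman_weight b"
    "(\<forall>c. b < c \<and> c < 1 \<longrightarrow> 1 - neuman_weight c < p) \<longleftrightarrow> 1 / 3 \<le> p"
proof -
  have "(neuman_weight \<longlongrightarrow> neuman_weight b) (at_right b)"
    using isCont_neuman_weight[of b] assms by (simp add: isCont_def filterlim_at_split)
  hence "((\<lambda>c. 1 - neuman_weight c) \<longlongrightarrow> 1 - neuman_weight b) (at_right b)"
    by (intro tendsto_intros)
  thus "(\<forall>c. b < c \<and> c < 1 \<longrightarrow> p < 1 - neuman_weight c) \<longleftrightarrow> p \<le> 1 - neuman_weight b"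
    using eventually_at_right_real[OF assms(2)] assms
    by (intro all_less_iff_le_limit) (auto intro: neuman_weight_strict_antimono)
  have "((\<lambda>c. 1 - neuman_weight c) \<longlongrightarrow> 1 / 3) (at_left 1)"
    using tendsto_diff[OF tendsto_const tendsto_neuman_weight(2), of 1] by simp
  thus "(\<forall>c. b < c \<and> c < 1 \<longrightarrow> 1 - neuman_weight c < p) \<longleftrightarrow> 1 / 3 \<le> p"
    using eventually_at_left_real[OF assms(2)] neuman_weight_less_1(1) assms
    by (intro all_greater_iff_ge_limit) force+
qed

section \<open>Values of the weight at the finite endpoints\<close>

lemma neuman_weight_2:
  "neuman_weight 2 = (2 * sqrt 3 - ln (2 + sqrt 3)) / (2 * sqrt 3 + ln (2 + sqrt 3))"
proof -
  have "inverse_SB 2 = ln (2 + sqrt 3) / sqrt 3"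
    by (simp add: inverse_SB_greater_1 arcosh_real_def)
  hence "2 - inverse_SB 2 = (2 * sqrt 3 - ln (2 + sqrt 3)) / sqrt 3"
    "2 + inverse_SB 2 = (2 * sqrt 3 + ln (2 + sqrt 3)) / sqrt 3"
    by (simp_all add: diff_divide_distrib add_divide_distrib)
  thus ?thesis by (simp add: neuman_weight_def)
qed

lemma neuman_weight_half:
  "1 - neuman_weight (1 / 2) = (9 * sqrt 3 - 4 * pi) / (3 * sqrt 3 + 4 * pi)"
proof -
  have "arccos (1 / 2) = pi / 3"
    using arccos_cos[of "pi / 3"] by (simp add: cos_60)
  moreover have "sqrt (1 - (1 / 2)\<^sup>2) = sqrt 3 / 2"
    by (simp add: power2_eq_square real_sqrt_divide)
  moreover have "inverse_SB (1 / 2) = arccos (1 / 2) / sqrt (1 - (1 / 2)\<^sup>2)"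
    by (rule inverse_SB_less_1) simp
  ultimately have "inverse_SB (1 / 2) = 2 * pi / (3 * sqrt 3)"
    by (simp only:) simp
  moreover have "0 < 3 * sqrt 3 + 4 * pi" by (simp add: add_pos_pos)
  moreover have "0 < inverse_SB (1 / 2)" by (rule inverse_SB_pos) simp_all
  ultimately show ?thesis
    by (simp add: neuman_weight_def divide_simps) (simp add: algebra_simps)
qed

section \<open>Reduction of the mean inequalities to the weight\<close>

text \<open>As \<open>1 / h > 1 / m\<close>, the combination increases strictly with the coefficient
  of \<open>1 / h\<close>; comparing combinations amounts to comparing coefficients.\<close>

lemma convex_reciprocal_less_iff:
  fixes h m p q :: "'a :: linordered_field"
  assumes "0 < h" "h < m"
  shows "p / h + (1 - p) / m < q / h + (1 - q) / m \<longleftrightarrow> p < q"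
proof -
  have "q / h + (1 - q) / m - (p / h + (1 - p) / m) = (q - p) * (1 / h - 1 / m)"
    by (simp add: diff_divide_distrib algebra_simps)
  moreover have "0 < 1 / h - 1 / m" using assms by (simp add: frac_less2)
  ultimately show ?thesis
    using diff_gt_0_iff_gt[of "q / h + (1 - q) / m" "p / h + (1 - p) / m"]
    by (simp add: zero_less_mult_iff)
qed

text \<open>One parameter governs both ratios, since \<open>4 * a * b\<close> and
  \<open>2 * (a^2 + b^2)\<close> are \<open>(a + b)^2\<close> minus and plus
  \<open>(a - b)^2\<close>.\<close>

lemma means_parametrization:
  fixes a b :: real
  assumes "0 < a" "0 < b"
  defines "t \<equiv> ((a - b) / (a + b))\<^sup>2"
  shows "harmonic_mean a b = arithmetic_mean a b * (1 - t)"
    "contraharmonic_mean a b = arithmetic_mean a b * (1 + t)"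
  unfolding harmonic_mean_def arithmetic_mean_def contraharmonic_mean_def t_def
  using assms by (simp_all add: power_divide divide_simps) (simp_all add: power2_eq_square algebra_simps)

lemma means_ordered:
  fixes a b :: real
  assumes "0 < a" "0 < b" "a \<noteq> b"
  defines "t \<equiv> ((a - b) / (a + b))\<^sup>2"
  shows "0 < t" "t < 1" "0 < harmonic_mean a b" "harmonic_mean a b < arithmetic_mean a b"
    "0 < arithmetic_mean a b" "arithmetic_mean a b < contraharmonic_mean a b"
proof -
  have m: "0 < arithmetic_mean a b" using assms by (simp add: arithmetic_mean_def)
  have "\<bar>a - b\<bar> < \<bar>a + b\<bar>" using assms by linarith
  hence "\<bar>(a - b) / (a + b)\<bar> < 1" using assms by simp
  thus t: "0 < t" "t < 1" using assms by (auto simp: t_def abs_square_less_1)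
  show "0 < harmonic_mean a b" "harmonic_mean a b < arithmetic_mean a b"
    "0 < arithmetic_mean a b" "arithmetic_mean a b < contraharmonic_mean a b"
    unfolding means_parametrization[OF assms(1,2), folded t_def] using m t by simp_all
qed

text \<open>The double complement in the second and fourth equations gives all four the shape
  \<open>p / h + (1 - p) / m\<close> with \<open>h < m\<close>, ready for comparing
  coefficients.\<close>

lemma inverse_neuman_means:
  fixes a b :: real
  assumes "0 < a" "0 < b" "a \<noteq> b"
  defines "t \<equiv> ((a - b) / (a + b))\<^sup>2"
  shows "1 / N_AH a b = neuman_weight (1 / (1 - t)) / harmonic_mean a b
      + (1 - neuman_weight (1 / (1 - t))) / arithmetic_mean a b"
    "1 / N_HA a b = (1 - neuman_weight (1 - t)) / harmonic_mean a b
      + (1 - (1 - neuman_weight (1 - t))) / arithmetic_mean a b"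
    "1 / N_CA a b = neuman_weight (1 + t) / arithmetic_mean a b
      + (1 - neuman_weight (1 + t)) / contraharmonic_mean a b"
    "1 / N_AC a b = (1 - neuman_weight (1 / (1 + t))) / arithmetic_mean a b
      + (1 - (1 - neuman_weight (1 / (1 + t)))) / contraharmonic_mean a b"
proof -
  define h m c where "h = harmonic_mean a b" and "m = arithmetic_mean a b"
    and "c = contraharmonic_mean a b"
  have order: "0 < h" "h < m" "0 < m" "m < c"
    using means_ordered[OF assms(1-3)] by (simp_all add: h_def m_def c_def)
  have "h = m * (1 - t)" "c = m * (1 + t)"
    using means_parametrization[OF assms(1,2)] by (simp_all add: h_def m_def c_def t_def)
  hence quot: "m / h = 1 / (1 - t)" "h / m = 1 - t" "c / m = 1 + t" "m / c = 1 / (1 + t)"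
    using order by simp_all
  show "1 / N_AH a b = neuman_weight (1 / (1 - t)) / harmonic_mean a b
      + (1 - neuman_weight (1 / (1 - t))) / arithmetic_mean a b"
    "1 / N_HA a b = (1 - neuman_weight (1 - t)) / harmonic_mean a b
      + (1 - (1 - neuman_weight (1 - t))) / arithmetic_mean a b"
    "1 / N_CA a b = neuman_weight (1 + t) / arithmetic_mean a b
      + (1 - neuman_weight (1 + t)) / contraharmonic_mean a b"
    "1 / N_AC a b = (1 - neuman_weight (1 / (1 + t))) / arithmetic_mean a b
      + (1 - (1 - neuman_weight (1 / (1 + t)))) / contraharmonic_mean a b"
    using order inverse_neuman_mean[of m h] inverse_neuman_mean[of h m]
      inverse_neuman_mean[of c m] inverse_neuman_mean[of m c]
    by (simp_all add: N_AH_def N_HA_def N_CA_def N_AC_def quot flip: h_def m_def c_def)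
qed

lemma mean_inequalities_iff:
  fixes a b p :: real
  assumes "0 < a" "0 < b" "a \<noteq> b"
  defines "t \<equiv> ((a - b) / (a + b))\<^sup>2"
  shows "p / harmonic_mean a b + (1 - p) / arithmetic_mean a b < 1 / N_AH a b
      \<longleftrightarrow> p < neuman_weight (1 / (1 - t))"
    "1 / N_AH a b < p / harmonic_mean a b + (1 - p) / arithmetic_mean a b
      \<longleftrightarrow> neuman_weight (1 / (1 - t)) < p"
    "p / harmonic_mean a b + (1 - p) / arithmetic_mean a b < 1 / N_HA a b
      \<longleftrightarrow> p < 1 - neuman_weight (1 - t)"
    "1 / N_HA a b < p / harmonic_mean a b + (1 - p) / arithmetic_mean a b
      \<longleftrightarrow> 1 - neuman_weight (1 - t) < p"
    "p / arithmetic_mean a b + (1 - p) / contraharmonic_mean a b < 1 / N_CA a b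
      \<longleftrightarrow> p < neuman_weight (1 + t)"
    "1 / N_CA a b < p / arithmetic_mean a b + (1 - p) / contraharmonic_mean a b
      \<longleftrightarrow> neuman_weight (1 + t) < p"
    "p / arithmetic_mean a b + (1 - p) / contraharmonic_mean a b < 1 / N_AC a b
      \<longleftrightarrow> p < 1 - neuman_weight (1 / (1 + t))"
    "1 / N_AC a b < p / arithmetic_mean a b + (1 - p) / contraharmonic_mean a b
      \<longleftrightarrow> 1 - neuman_weight (1 / (1 + t)) < p"
  unfolding inverse_neuman_means[OF assms(1-3)] t_def
  by (intro convex_reciprocal_less_iff means_ordered[OF assms(1-3)])+

text \<open>Each map carries the unit interval onto the range of one ratio; the values of
  \<open>t\<close> used in the proof are the preimages of \<open>c\<close>.\<close>

lemma all_mean_ratio_iff: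
  fixes P :: "real \<Rightarrow> bool"
  shows "(\<forall>t. 0 < t \<and> t < 1 \<longrightarrow> P (1 / (1 - t))) \<longleftrightarrow> (\<forall>c. 1 < c \<longrightarrow> P c)"
    "(\<forall>t. 0 < t \<and> t < 1 \<longrightarrow> P (1 - t)) \<longleftrightarrow> (\<forall>c. 0 < c \<and> c < 1 \<longrightarrow> P c)"
    "(\<forall>t. 0 < t \<and> t < 1 \<longrightarrow> P (1 + t)) \<longleftrightarrow> (\<forall>c. 1 < c \<and> c < 2 \<longrightarrow> P c)"
    "(\<forall>t. 0 < t \<and> t < 1 \<longrightarrow> P (1 / (1 + t))) \<longleftrightarrow> (\<forall>c. 1 / 2 < c \<and> c < 1 \<longrightarrow> P c)"
proof -
  show "(\<forall>t. 0 < t \<and> t < 1 \<longrightarrow> P (1 / (1 - t))) \<longleftrightarrow> (\<forall>c. 1 < c \<longrightarrow> P c)"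
  proof (intro iffI allI impI)
    fix c :: real assume "\<forall>t. 0 < t \<and> t < 1 \<longrightarrow> P (1 / (1 - t))" "1 < c"
    thus "P c" by (auto dest!: spec[of _ "1 - 1 / c"])
  qed auto
  show "(\<forall>t. 0 < t \<and> t < 1 \<longrightarrow> P (1 - t)) \<longleftrightarrow> (\<forall>c. 0 < c \<and> c < 1 \<longrightarrow> P c)"
  proof (intro iffI allI impI)
    fix c :: real assume "\<forall>t. 0 < t \<and> t < 1 \<longrightarrow> P (1 - t)" "0 < c \<and> c < 1"
    thus "P c" by (auto dest!: spec[of _ "1 - c"])
  qed auto
  show "(\<forall>t. 0 < t \<and> t < 1 \<longrightarrow> P (1 + t)) \<longleftrightarrow> (\<forall>c. 1 < c \<and> c < 2 \<longrightarrow> P c)"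
  proof (intro iffI allI impI)
    fix c :: real assume "\<forall>t. 0 < t \<and> t < 1 \<longrightarrow> P (1 + t)" "1 < c \<and> c < 2"
    thus "P c" by (auto dest!: spec[of _ "c - 1"])
  qed auto
  show "(\<forall>t. 0 < t \<and> t < 1 \<longrightarrow> P (1 / (1 + t))) \<longleftrightarrow> (\<forall>c. 1 / 2 < c \<and> c < 1 \<longrightarrow> P c)"
  proof (intro iffI allI impI)
    fix c :: real assume "\<forall>t. 0 < t \<and> t < 1 \<longrightarrow> P (1 / (1 + t))" "1 / 2 < c \<and> c < 1"
    thus "P c" by (auto dest!: spec[of _ "1 / c - 1"] simp: field_simps)
  qed (auto simp: field_simps)
qed

section \<open>Decimal bounds for the two constants\<close>

lemma sqrt_3_bounds: "1.73205 < sqrt 3" "sqrt 3 < (1.73206 :: real)"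
  by (rule real_less_rsqrt, simp add: power2_eq_square)
    (rule real_less_lsqrt, simp_all add: power2_eq_square)

lemma constant_AC_bounds:
  "0.1701 \<le> (9 * sqrt 3 - 4 * pi) / (3 * sqrt 3 + 4 * pi)"
  "(9 * sqrt 3 - 4 * pi) / (3 * sqrt 3 + 4 * pi) < 0.1702"
proof -
  have "0 < 3 * sqrt 3 + 4 * pi" by (simp add: add_pos_pos)
  thus "0.1701 \<le> (9 * sqrt 3 - 4 * pi) / (3 * sqrt 3 + 4 * pi)"
  "(9 * sqrt 3 - 4 * pi) / (3 * sqrt 3 + 4 * pi) < 0.1702"
    using pi_approx sqrt_3_bounds by (simp_all add: pos_le_divide_eq pos_divide_less_eq)
qed

text \<open>With \<open>r = ln (2 + sqrt 3) / (2 * sqrt 3)\<close> the constant for C and A is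
  \<open>(1 - r) / (1 + r)\<close>. Its four decimals require \<open>r\<close> between 0.5509/1.4491
  and 0.5510/1.4490, here rounded inward.\<close>

lemma ln_2_plus_sqrt_3_bounds:
  "0.3801671 * (2 * sqrt 3) < ln (2 + sqrt 3)" "ln (2 + sqrt 3) < 0.38026 * (2 * sqrt 3)"
proof -
  define s where "s = sqrt (3::real)"
  have s: "0 < s" "s * s = 3" by (auto simp: s_def)
  \<comment> \<open>The series of \<open>ln x\<close> in odd powers of
    \<open>(x - 1) / (x + 1)\<close> is taken at \<open>1 / sqrt 3\<close>, whose square is
    rational, so each partial sum is a rational multiple of \<open>2 * s\<close>. Eight terms is the
    least number exceeding the lower bound.\<close>
  have y: "(2 + s - 1) / (2 + s + 1) = s / 3"
    using s by (simp add: divide_simps) (simp add: algebra_simps)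
  have odd_power: "(s / 3) ^ (2 * k + 1) = s / 3 * (1 / 3) ^ k" for k
    using s by (simp add: power_mult power2_eq_square)
  have square: "(s / 3)\<^sup>2 = 1 / 3"
    using s by (simp add: power2_eq_square)
  have "(\<Sum>k<8. 2 * (s / 3 * (1 / 3) ^ k) / of_nat (2 * k + 1))
      = 2 * s * (\<Sum>k<8. (1 / 3) ^ (k + 1) / of_nat (2 * k + 1))"
    by (simp add: sum_distrib_left mult.assoc)
  also have "(\<Sum>k<8. (1 / 3) ^ (k + 1) / of_nat (2 * k + 1)) = (7490344 / 19702683 :: real)"
    by (simp add: eval_nat_numeral)
  finally show "0.3801671 * (2 * sqrt 3) < ln (2 + sqrt 3)" "ln (2 + sqrt 3) < 0.38026 * (2 * sqrt 3)"
    using ln_approx_bounds[of "2 + s" 8, unfolded y odd_power square] s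
    unfolding s_def[symmetric] by (simp_all add: field_simps)
qed

lemma constant_CA_bounds:
  "0.4490 \<le> (2 * sqrt 3 - ln (2 + sqrt 3)) / (2 * sqrt 3 + ln (2 + sqrt 3))"
  "(2 * sqrt 3 - ln (2 + sqrt 3)) / (2 * sqrt 3 + ln (2 + sqrt 3)) < 0.4491"
proof -
  have "0 < ln (2 + sqrt 3)" by (simp add: add_pos_pos)
  hence "0 < 2 * sqrt 3 + ln (2 + sqrt 3)" by (simp add: add_pos_pos)
  thus "0.4490 \<le> (2 * sqrt 3 - ln (2 + sqrt 3)) / (2 * sqrt 3 + ln (2 + sqrt 3))"
    "(2 * sqrt 3 - ln (2 + sqrt 3)) / (2 * sqrt 3 + ln (2 + sqrt 3)) < 0.4491"
    using ln_2_plus_sqrt_3_bounds by (simp_all add: pos_le_divide_eq pos_divide_less_eq)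
qed

theorem theorem1p3:
  fixes alpha5 alpha6 alpha7 alpha8 beta5 beta6 beta7 beta8 :: real
  shows "((\<forall>a b :: real. a > 0 \<longrightarrow> b > 0 \<longrightarrow> a \<noteq> b \<longrightarrow>
          alpha5 / harmonic_mean a b + (1 - alpha5) / arithmetic_mean a b < 1 / N_AH a b \<and>
          1 / N_AH a b < beta5 / harmonic_mean a b + (1 - beta5) / arithmetic_mean a b \<and>
          alpha6 / harmonic_mean a b + (1 - alpha6) / arithmetic_mean a b < 1 / N_HA a b \<and>
          1 / N_HA a b < beta6 / harmonic_mean a b + (1 - beta6) / arithmetic_mean a b \<and>
          alpha7 / arithmetic_mean a b + (1 - alpha7) / contraharmonic_mean a b < 1 / N_CA a b \<and>
          1 / N_CA a b < beta7 / arithmetic_mean a b + (1 - beta7) / contraharmonic_mean a b \<and>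
          alpha8 / arithmetic_mean a b + (1 - alpha8) / contraharmonic_mean a b < 1 / N_AC a b \<and>
          1 / N_AC a b < beta8 / arithmetic_mean a b + (1 - beta8) / contraharmonic_mean a b)
      \<longleftrightarrow>
         (alpha5 \<le> 0 \<and> beta5 \<ge> 2 / 3 \<and>
          alpha6 \<le> 0 \<and> beta6 \<ge> 1 / 3 \<and>
          alpha7 \<le> (2 * sqrt 3 - ln (2 + sqrt 3)) / (2 * sqrt 3 + ln (2 + sqrt 3)) \<and> beta7 \<ge> 2 / 3 \<and>
          alpha8 \<le> (9 * sqrt 3 - 4 * pi) / (3 * sqrt 3 + 4 * pi) \<and> beta8 \<ge> 1 / 3)) \<and>
         0.4490 \<le> (2 * sqrt 3 - ln (2 + sqrt 3)) / (2 * sqrt 3 + ln (2 + sqrt 3)) \<and>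
         (2 * sqrt 3 - ln (2 + sqrt 3)) / (2 * sqrt 3 + ln (2 + sqrt 3)) < 0.4491 \<and>
         0.1701 \<le> (9 * sqrt 3 - 4 * pi) / (3 * sqrt 3 + 4 * pi) \<and>
         (9 * sqrt 3 - 4 * pi) / (3 * sqrt 3 + 4 * pi) < 0.1702"
    (is "((\<forall>a b. _ \<longrightarrow> _ \<longrightarrow> _ \<longrightarrow> ?ineqs a b) \<longleftrightarrow> ?sharp) \<and> _")
proof -
  define P5 where "P5 c \<longleftrightarrow> alpha5 < neuman_weight c \<and> neuman_weight c < beta5" for c
  define P6 where "P6 c \<longleftrightarrow> alpha6 < 1 - neuman_weight c \<and> 1 - neuman_weight c < beta6" for c
  define P7 where "P7 c \<longleftrightarrow> alpha7 < neuman_weight c \<and> neuman_weight c < beta7" for c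
  define P8 where "P8 c \<longleftrightarrow> alpha8 < 1 - neuman_weight c \<and> 1 - neuman_weight c < beta8" for c
  \<comment> \<open>All eight inequalities become a condition on the single parameter
    \<open>t\<close>.\<close>
  define Q where "Q t \<longleftrightarrow> P5 (1 / (1 - t)) \<and> P6 (1 - t) \<and> P7 (1 + t) \<and> P8 (1 / (1 + t))" for t
  have ineqs: "?ineqs a b \<longleftrightarrow> Q (((a - b) / (a + b))\<^sup>2)" if "0 < a" "0 < b" "a \<noteq> b" for a b
    unfolding mean_inequalities_iff[OF that] Q_def P5_def P6_def P7_def P8_def by blast
  have "(\<forall>a b. a > 0 \<longrightarrow> b > 0 \<longrightarrow> a \<noteq> b \<longrightarrow> ?ineqs a b) \<longleftrightarrow> (\<forall>t. 0 < t \<and> t < 1 \<longrightarrow> Q t)"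
  proof (intro iffI allI impI)
    fix t :: real
    assume all: "\<forall>a b. a > 0 \<longrightarrow> b > 0 \<longrightarrow> a \<noteq> b \<longrightarrow> ?ineqs a b" and t: "0 < t \<and> t < 1"
    \<comment> \<open>The witnesses \<open>a = 1 + sqrt t\<close> and \<open>b = 1 - sqrt t\<close>
      satisfy \<open>(a - b) / (a + b) = sqrt t\<close>, so every \<open>t\<close> in the unit
      interval occurs.\<close>
    have "0 < 1 + sqrt t" "0 < 1 - sqrt t" "1 + sqrt t \<noteq> 1 - sqrt t"
      using t by (auto simp: add_pos_pos)
    with all ineqs have "Q (((1 + sqrt t - (1 - sqrt t)) / (1 + sqrt t + (1 - sqrt t)))\<^sup>2)" by blast
    thus "Q t" using t by simp
  next
    fix a b :: real
    assume "\<forall>t. 0 < t \<and> t < 1 \<longrightarrow> Q t" and ab: "a > 0" "b > 0" "a \<noteq> b"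
    thus "?ineqs a b" unfolding ineqs[OF ab] using means_ordered(1,2)[OF ab] by blast
  qed
  also have "\<dots> \<longleftrightarrow> (\<forall>t. 0 < t \<and> t < 1 \<longrightarrow> P5 (1 / (1 - t))) \<and> (\<forall>t. 0 < t \<and> t < 1 \<longrightarrow> P6 (1 - t)) \<and>
      (\<forall>t. 0 < t \<and> t < 1 \<longrightarrow> P7 (1 + t)) \<and> (\<forall>t. 0 < t \<and> t < 1 \<longrightarrow> P8 (1 / (1 + t)))"
    unfolding Q_def by blast
  also have "\<dots> \<longleftrightarrow> (\<forall>c. 1 < c \<longrightarrow> P5 c) \<and> (\<forall>c. 0 < c \<and> c < 1 \<longrightarrow> P6 c) \<and>
      (\<forall>c. 1 < c \<and> c < 2 \<longrightarrow> P7 c) \<and> (\<forall>c. 1 / 2 < c \<and> c < 1 \<longrightarrow> P8 c)"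
    by (simp only: all_mean_ratio_iff(1)[of P5] all_mean_ratio_iff(2)[of P6]
        all_mean_ratio_iff(3)[of P7] all_mean_ratio_iff(4)[of P8])
  also have "(\<forall>c. 1 < c \<longrightarrow> P5 c) \<longleftrightarrow> alpha5 \<le> 0 \<and> 2 / 3 \<le> beta5"
    using neuman_weight_sharp_greater_1[of alpha5] neuman_weight_sharp_greater_1[of beta5] unfolding P5_def by blast
  also have "(\<forall>c. 0 < c \<and> c < 1 \<longrightarrow> P6 c) \<longleftrightarrow> alpha6 \<le> 0 \<and> 1 / 3 \<le> beta6"
    using neuman_weight_sharp_less_1[of alpha6] neuman_weight_sharp_less_1[of beta6] unfolding P6_def by blast
  also have "(\<forall>c. 1 < c \<and> c < 2 \<longrightarrow> P7 c) \<longleftrightarrow> alpha7 \<le> neuman_weight 2 \<and> 2 / 3 \<le> beta7"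
    using neuman_weight_sharp_between_1_and[of 2 alpha7] neuman_weight_sharp_between_1_and[of 2 beta7]
    unfolding P7_def by force
  also have "(\<forall>c. 1 / 2 < c \<and> c < 1 \<longrightarrow> P8 c) \<longleftrightarrow>
      alpha8 \<le> 1 - neuman_weight (1 / 2) \<and> 1 / 3 \<le> beta8"
    using neuman_weight_sharp_between_and_1[of "1 / 2" alpha8] neuman_weight_sharp_between_and_1[of "1 / 2" beta8]
    unfolding P8_def by force
  finally show ?thesis
    unfolding neuman_weight_2 neuman_weight_half
    using constant_CA_bounds constant_AC_bounds by blast
qed

end
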